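(* Let $G$ be a connected graph of order $n\ge 2$ and let $H$ be an arbitrary graph of order at least $2$. Suppose that for each adjacency basis $W$ of $H$ there exist a vertex of $H$ with adjacency representation entirely $1$ with respect to $W$ and a vertex of $H$ with adjacency representation entirely $2$ with respect to $W$. Then $\beta(G[H])=\beta(G[\overline{H}])=n(\beta_2(H)+1)-\iota(G)$.
   Context: All graphs are finite and simple; $\overline{H}$ is the complement of $H$, and $u\sim v$ means that $u,v$ are adjacent. For a connected graph $X$, an ordered set $W=\{w_1,\dots,w_k\}\subseteq V(X)$ is a resolving set if the vectors $(d_X(v,w_1),\dots,d_X(v,w_k))$, $v\in V(X)$, are pairwise distinct ($d_X$ is the graph distance); the metric dimension $\beta(X)$ is the minimum cardinality of a resolving set of $X$. For any graph $H$ and vertices $v,w$, set $a_H(v,w)=0$ if $v=w$, $a_H(v,w)=1$ if $v\sim w$, and $a_H(v,w)=2$ if $v\ne w$ and $v\nsim w$. For an ordered set $W=\{w_1,\dots,w_k\}\subseteq V(H)$ the adjacency representation of $v$ with respect to $W$ is $r_2(v|W)=(a_H(v,w_1),\dots,a_H(v,w_k))$; it is entirely $i$ if all its entries equal $i$. $W$ is an adjacency resolving set of $H$ if distinct vertices of $H$ have distinct adjacency representations with respect to $W$; the adjacency metric dimension $\beta_2(H)$ is the minimum cardinality of an adjacency resolving set, and an adjacency basis of $H$ is an adjacency resolving set of cardinality $\beta_2(H)$. The lexicographic product $G[H]$ has vertex set $V(G)\times V(H)$, with $(v,u)$ and $(v',u')$ adjacent iff $v\sim v'$ in $G$, or $v=v'$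 and $u\sim u'$ in $H$. Two distinct vertices $u,v$ of $G$ are twins if $N(v)\setminus\{u\}=N(u)\setminus\{v\}$, where $N(x)$ is the set of neighbors of $x$; the relation $u\equiv v$ iff $u=v$ or $u,v$ are twins is an equivalence relation on $V(G)$, and $\iota(G)$ denotes the number of its equivalence classes. *)

theory Defs
  imports "Graph_Theory.Graph_Theory"
begin

text \<open>
  A finite simple graph is a \<^term>\<open>pair_graph\<close>: a finite, symmetric, loop-free relation on a
  finite vertex set. Ordered vertex sets \<open>(w\<^sub>1, \<dots>, w\<^sub>k)\<close> are distinct lists.
\<close>

definition complement_graph :: "'a pair_pre_digraph \<Rightarrow> 'a pair_pre_digraph" where
  "complement_graph H =
    \<lparr> pverts = pverts H,
      parcs = {(u, v). u \<in> pverts H \<and> v \<in> pverts H \<and> u \<noteq> v \<and> (u, v) \<notin> parcs H} \<rparr>"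

definition lexicographic_product ::
  "'a pair_pre_digraph \<Rightarrow> 'b pair_pre_digraph \<Rightarrow> ('a \<times> 'b) pair_pre_digraph" where
  "lexicographic_product G H =
    \<lparr> pverts = pverts G \<times> pverts H,
      parcs = {((v, u), (v', u')).
        (v, u) \<in> pverts G \<times> pverts H \<and> (v', u') \<in> pverts G \<times> pverts H \<and>
        ((v, v') \<in> parcs G \<or> v = v' \<and> (u, u') \<in> parcs H)} \<rparr>"

lemma pair_graph_complement_graph:
  assumes "pair_graph H"
  shows "pair_graph (complement_graph H)"
proof -
  interpret pair_graph H by fact
  have "parcs (complement_graph H) \<subseteq> pverts H \<times> pverts H"
    by (auto simp: complement_graph_def)
  then have "finite (parcs (complement_graph H))"
    by (rule finite_subset) simp
  moreover have "sym (parcs (complement_graph H))"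
    by (auto simp: complement_graph_def sym_def intro: arcs_symmetric)
  ultimately show ?thesis
    by unfold_locales (auto simp: complement_graph_def symmetric_def)
qed

lemma pair_graph_lexicographic_product:
  assumes "pair_graph G" and "pair_graph H"
  shows "pair_graph (lexicographic_product G H)"
proof -
  interpret G: pair_graph G by fact
  interpret H: pair_graph H by fact
  have "parcs (lexicographic_product G H) \<subseteq> (pverts G \<times> pverts H) \<times> (pverts G \<times> pverts H)"
    by (auto simp: lexicographic_product_def)
  then have "finite (parcs (lexicographic_product G H))"
    by (rule finite_subset) simp
  moreover have "sym (parcs (lexicographic_product G H))"
    by (auto simp: lexicographic_product_def sym_def intro: G.arcs_symmetric H.arcs_symmetric)
  ultimately show ?thesis
    by unfold_locales
      (auto simp: lexicographic_product_def symmetric_def dest: G.no_loops' H.no_loops')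
qed

text \<open>
  With all arcs of weight 1, the cost of a walk is its length, so that the library's
  shortest-path weight is the usual graph distance (\<open>\<infinity>\<close> between different components).
\<close>

definition gdist :: "'a pair_pre_digraph \<Rightarrow> 'a \<Rightarrow> 'a \<Rightarrow> ereal" where
  "gdist X u v = wf_digraph.\<mu> (with_proj X) (\<lambda>_. 1) u v"

lemma gdist_conv_length:
  assumes "pair_graph X"
  shows "gdist X u v = (INF p \<in> {p. pre_digraph.awalk (with_proj X) u p v}. ereal (length p))"
proof -
  interpret pair_graph X by fact
  have "awalk_cost (\<lambda>_. 1) p = length p" for p
    by (induct p) auto
  then show ?thesis
    unfolding gdist_def \<mu>_def by simp
qed

definition metric_rep :: "'a pair_pre_digraph \<Rightarrow> 'a list \<Rightarrow> 'a \<Rightarrow> ereal list" where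
  "metric_rep X ws v = map (gdist X v) ws"

definition resolving :: "'a pair_pre_digraph \<Rightarrow> 'a list \<Rightarrow> bool" where
  "resolving X ws \<longleftrightarrow>
    distinct ws \<and> set ws \<subseteq> pverts X \<and> inj_on (metric_rep X ws) (pverts X)"

definition metric_dim :: "'a pair_pre_digraph \<Rightarrow> nat" where
  "metric_dim X = (LEAST k. \<exists>ws. resolving X ws \<and> length ws = k)"

definition adj_code :: "'a pair_pre_digraph \<Rightarrow> 'a \<Rightarrow> 'a \<Rightarrow> nat" where
  "adj_code H v w = (if v = w then 0 else if (v, w) \<in> parcs H then 1 else 2)"

definition adj_rep :: "'a pair_pre_digraph \<Rightarrow> 'a list \<Rightarrow> 'a \<Rightarrow> nat list" where
  "adj_rep H ws v = map (adj_code H v) ws"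

definition adj_resolving :: "'a pair_pre_digraph \<Rightarrow> 'a list \<Rightarrow> bool" where
  "adj_resolving H ws \<longleftrightarrow>
    distinct ws \<and> set ws \<subseteq> pverts H \<and> inj_on (adj_rep H ws) (pverts H)"

definition adj_metric_dim :: "'a pair_pre_digraph \<Rightarrow> nat" where
  "adj_metric_dim H = (LEAST k. \<exists>ws. adj_resolving H ws \<and> length ws = k)"

definition adj_basis :: "'a pair_pre_digraph \<Rightarrow> 'a list \<Rightarrow> bool" where
  "adj_basis H ws \<longleftrightarrow> adj_resolving H ws \<and> length ws = adj_metric_dim H"

definition entirely :: "nat \<Rightarrow> nat list \<Rightarrow> bool" where
  "entirely i r \<longleftrightarrow> (\<forall>x \<in> set r. x = i)"

definition nbrs :: "'a pair_pre_digraph \<Rightarrow> 'a \<Rightarrow> 'a set" where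
  "nbrs G x = {y. (x, y) \<in> parcs G}"

definition twins :: "'a pair_pre_digraph \<Rightarrow> 'a \<Rightarrow> 'a \<Rightarrow> bool" where
  "twins G u v \<longleftrightarrow> u \<noteq> v \<and> nbrs G v - {u} = nbrs G u - {v}"

definition twin_rel :: "'a pair_pre_digraph \<Rightarrow> 'a rel" where
  "twin_rel G = {(u, v). u \<in> pverts G \<and> v \<in> pverts G \<and> (u = v \<or> twins G u v)}"

definition num_twin_classes :: "'a pair_pre_digraph \<Rightarrow> nat" where
  "num_twin_classes G = card (pverts G // twin_rel G)"

end

theory Submission
  imports Defs
begin

text \<open>
  Let \<open>S\<close> be a set of vertices of \<open>G[H]\<close>, and write \<open>S `` {v}\<close> for the part of \<open>S\<close> in the copy
  of \<open>H\<close> over the vertex \<open>v\<close> of \<open>G\<close>. Two vertices over the same \<open>v\<close> have the same distance to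
  everything over other vertices, and, since \<open>v\<close> has a neighbour, their distances inside the copy
  are the codes \<open>0, 1, 2\<close> of \<open>adj_code H\<close>. So each fibre of a resolving \<open>S\<close> must be adjacency
  resolving for \<open>H\<close>. Two vertices over distinct \<open>v\<close> and \<open>w\<close> that are not twins are separated by
  any element of \<open>S\<close> over a vertex adjacent to exactly one of \<open>v\<close> and \<open>w\<close>. If \<open>v\<close> and \<open>w\<close> are
  twins, at distance \<open>i \<in> {1, 2}\<close>, only the fibres over \<open>v\<close> and \<open>w\<close> can help, and \<open>(v, u)\<close>,
  \<open>(w, u')\<close> stay unseparated exactly when \<open>u\<close> and \<open>u'\<close> have adjacency representations that are
  entirely \<open>i\<close> with respect to these two fibres. This is \<open>separating_lexicographic_product_iff\<close>.

  It remains to minimise the sum of the fibre sizes (\<open>metric_dim_lexicographic_product\<close>). Each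
  fibre has at least \<open>adj_metric_dim H\<close> elements, and by the hypothesis on \<open>H\<close> a fibre of exactly
  this size has vertices that are entirely \<open>1\<close> and entirely \<open>2\<close>. Hence at most one fibre per twin
  class is that small, which is the lower bound. Conversely, put a fixed adjacency basis \<open>W\<close> over
  one representative of each twin class, and over each other vertex put \<open>W\<close> together with the
  vertex that is entirely \<open>i\<close> with respect to \<open>W\<close>, where \<open>i\<close> is the common distance within the
  class. That vertex is the only one of its kind, and it has code \<open>0\<close> to itself, so the enlarged
  fibre no longer admits a vertex that is entirely \<open>i\<close>.

  Complementing \<open>H\<close> exchanges the codes \<open>1\<close> and \<open>2\<close>. The adjacency resolving sets and the
  hypothesis on \<open>H\<close> are therefore the same for \<open>H\<close> and its complement, and the formula applies
  to both.
\<close>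

section \<open>Separating sets\<close>

text \<open>
  Both dimensions are minima over lists, but only the underlying set matters. This set version
  covers the two of them, with \<open>d\<close> either \<open>gdist X\<close> or \<open>adj_code H\<close>.
\<close>

definition separating :: "('v \<Rightarrow> 'v \<Rightarrow> 'c) \<Rightarrow> 'v set \<Rightarrow> 'v set \<Rightarrow> bool" where
  "separating d V S \<longleftrightarrow>
    S \<subseteq> V \<and> (\<forall>x\<in>V. \<forall>y\<in>V. (\<forall>s\<in>S. d x s = d y s) \<longrightarrow> x = y)"

lemma separatingD:
  "separating d V S \<Longrightarrow> x \<in> V \<Longrightarrow> y \<in> V \<Longrightarrow> (\<And>s. s \<in> S \<Longrightarrow> d x s = d y s) \<Longrightarrow> x = y"
  by (auto simp: separating_def)

lemma separating_superset:
  "separating d V S \<Longrightarrow> S \<subseteq> T \<Longrightarrow> T \<subseteq> V \<Longrightarrow> separating d V T"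
  unfolding separating_def by (meson subset_iff)

lemma separating_set_iff:
  "separating d V (set ws) \<longleftrightarrow> set ws \<subseteq> V \<and> inj_on (\<lambda>v. map (d v) ws) V"
  by (auto simp: separating_def inj_on_def)

lemma ex_separating_list_iff:
  assumes "finite V"
  shows "(\<exists>ws. (distinct ws \<and> set ws \<subseteq> V \<and> inj_on (\<lambda>v. map (d v) ws) V) \<and> length ws = k) \<longleftrightarrow>
    (\<exists>S. separating d V S \<and> card S = k)" (is "?L \<longleftrightarrow> ?R")
proof
  assume ?L
  then show ?R
    by (metis separating_set_iff distinct_card)
next
  assume ?R
  then obtain S where S: "separating d V S" "card S = k" by blast
  then have "finite S" using assms by (auto simp: separating_def intro: finite_subset)
  then obtain ws where "set ws = S" "distinct ws" using finite_distinct_list by blast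
  then show ?L using S by (metis separating_set_iff distinct_card)
qed

lemma metric_dim_eq_Least_card:
  assumes "pair_graph X"
  shows "metric_dim X = (LEAST k. \<exists>S. separating (gdist X) (pverts X) S \<and> card S = k)"
proof -
  interpret pair_graph X by fact
  show ?thesis
    unfolding metric_dim_def resolving_def metric_rep_def
    by (simp only: ex_separating_list_iff[OF finite_verts[simplified with_proj_simps]])
qed

lemma adj_metric_dim_eq_Least_card:
  assumes "pair_graph H"
  shows "adj_metric_dim H = (LEAST k. \<exists>S. separating (adj_code H) (pverts H) S \<and> card S = k)"
proof -
  interpret pair_graph H by fact
  show ?thesis
    unfolding adj_metric_dim_def adj_resolving_def adj_rep_def
    by (simp only: ex_separating_list_iff[OF finite_verts[simplified with_proj_simps]])
qed

lemma pverts_complement_graph: "pverts (complement_graph H) = pverts H"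
  by (simp add: complement_graph_def)

lemma adj_code_complement_graph_iff:
  assumes "u \<in> pverts H" "w \<in> pverts H"
  shows "adj_code (complement_graph H) u w = 1 \<longleftrightarrow> adj_code H u w = 2"
    and "adj_code (complement_graph H) u w = 2 \<longleftrightarrow> adj_code H u w = 1"
  using assms by (auto simp: adj_code_def complement_graph_def)

text \<open>
  Exchanging the codes 1 and 2 does not affect which codes are equal.
\<close>

lemma separating_adj_code_complement_graph:
  "separating (adj_code (complement_graph H)) (pverts H) S \<longleftrightarrow>
    separating (adj_code H) (pverts H) S"
proof -
  have "adj_code (complement_graph H) x s = adj_code (complement_graph H) y s \<longleftrightarrow>
      adj_code H x s = adj_code H y s"
    if "x \<in> pverts H" "y \<in> pverts H" "s \<in> pverts H" for x y s
    using that by (auto simp: adj_code_def complement_graph_def)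
  then show ?thesis
    unfolding separating_def by (intro conj_cong refl ball_cong imp_cong) (auto dest: subsetD)
qed

lemma adj_metric_dim_complement_graph:
  assumes "pair_graph H"
  shows "adj_metric_dim (complement_graph H) = adj_metric_dim H"
  unfolding adj_metric_dim_eq_Least_card[OF assms]
    adj_metric_dim_eq_Least_card[OF pair_graph_complement_graph[OF assms]]
    pverts_complement_graph separating_adj_code_complement_graph ..

section \<open>Twin classes\<close>

lemma adj_code_commute:
  assumes "pair_graph G"
  shows "adj_code G u v = adj_code G v u"
proof -
  interpret pair_graph G by fact
  show ?thesis by (auto simp: adj_code_def intro: arcs_symmetric)
qed

lemma twins_commute: "twins G u v \<longleftrightarrow> twins G v u"
  by (auto simp: twins_def)

lemma twins_adjacent_iff:
  assumes "twins G u v" "x \<noteq> u" "x \<noteq> v"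
  shows "(u, x) \<in> parcs G \<longleftrightarrow> (v, x) \<in> parcs G"
  using assms unfolding twins_def nbrs_def by blast

text \<open>
  A vertex other than the three in question sees all of them alike. For the middle vertex \<open>v\<close>, go
  around the triangle: \<open>u\<close> is adjacent to \<open>v\<close> iff to \<open>w\<close>, because \<open>v\<close> and \<open>w\<close> are twins, and \<open>w\<close>
  is adjacent to \<open>u\<close> iff to \<open>v\<close>, because \<open>u\<close> and \<open>v\<close> are twins.
\<close>

lemma twins_trans:
  assumes "pair_graph G" "twins G u v" "twins G v w" "u \<noteq> w"
  shows "twins G u w"
proof -
  interpret pair_graph G by fact
  have sym: "(x, y) \<in> parcs G \<longleftrightarrow> (y, x) \<in> parcs G" for x y
    by (auto intro: arcs_symmetric)
  have irr: "(x, x) \<notin> parcs G" for x using no_loops' by blast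
  have ne: "u \<noteq> v" "v \<noteq> w" using assms by (auto simp: twins_def)
  have "(u, x) \<in> parcs G \<longleftrightarrow> (w, x) \<in> parcs G" if x: "x \<noteq> u" "x \<noteq> w" for x
  proof (cases "x = v")
    case True
    have "(u, v) \<in> parcs G \<longleftrightarrow> (w, u) \<in> parcs G" "(w, v) \<in> parcs G \<longleftrightarrow> (u, w) \<in> parcs G"
      using twins_adjacent_iff[OF assms(3), of u] twins_adjacent_iff[OF assms(2), of w]
        assms(4) ne sym by blast+
    then show ?thesis using True sym by blast
  next
    case False
    then show ?thesis
      using twins_adjacent_iff[OF assms(2), of x] twins_adjacent_iff[OF assms(3), of x] x by blast
  qed
  then have "x \<in> nbrs G w - {u} \<longleftrightarrow> x \<in> nbrs G u - {w}" for x
    using irr unfolding nbrs_def by (cases "x = u \<or> x = w") auto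
  then show ?thesis
    using assms(4) unfolding twins_def by blast
qed

lemma equiv_twin_rel:
  assumes "pair_graph G"
  shows "equiv (pverts G) (twin_rel G)"
proof (rule equivI)
  show "twin_rel G \<subseteq> pverts G \<times> pverts G" by (auto simp: twin_rel_def)
  show "refl_on (pverts G) (twin_rel G)" by (auto simp: refl_on_def twin_rel_def)
  show "sym (twin_rel G)" by (auto simp: sym_def twin_rel_def twins_commute)
  show "trans (twin_rel G)" by (auto simp: trans_def twin_rel_def dest: twins_trans[OF assms])
qed

text \<open>
  Every twin class is a clique or an independent set, so it has a single internal distance.
\<close>

lemma twin_class_adj_code_eq:
  assumes "pair_graph G" "twins G v t" "twins G v w"
  shows "adj_code G v t = adj_code G v w"
proof (cases "t = w")
  case False
  interpret pair_graph G by fact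
  have sym: "(x, y) \<in> parcs G \<longleftrightarrow> (y, x) \<in> parcs G" for x y
    by (auto intro: arcs_symmetric)
  have ne: "v \<noteq> t" "v \<noteq> w" using assms by (auto simp: twins_def)
  have "(v, t) \<in> parcs G \<longleftrightarrow> (v, w) \<in> parcs G"
    using twins_adjacent_iff[OF assms(2), of w] twins_adjacent_iff[OF assms(3), of t]
      ne False sym by blast
  then show ?thesis using ne by (simp add: adj_code_def)
qed simp

lemma card_le_num_twin_classes:
  assumes "pair_graph G" "T \<subseteq> pverts G"
    and "\<And>v w. v \<in> T \<Longrightarrow> w \<in> T \<Longrightarrow> \<not> twins G v w"
  shows "card T \<le> num_twin_classes G"
proof -
  interpret pair_graph G by fact
  have fin: "finite (pverts G)" using finite_verts by simp
  have "inj_on (\<lambda>v. twin_rel G `` {v}) T"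
  proof (rule inj_onI)
    fix v w assume vw: "v \<in> T" "w \<in> T" "twin_rel G `` {v} = twin_rel G `` {w}"
    then have "(v, w) \<in> twin_rel G"
      using assms(2) eq_equiv_class_iff[OF equiv_twin_rel[OF assms(1)]] by blast
    then show "v = w" using assms(3) vw by (auto simp: twin_rel_def)
  qed
  moreover have "(\<lambda>v. twin_rel G `` {v}) ` T \<subseteq> pverts G // twin_rel G"
    using assms(2) by (auto intro: quotientI)
  moreover have "finite (pverts G // twin_rel G)"
    using fin by (rule finite_quotient) (auto simp: twin_rel_def)
  ultimately show ?thesis
    unfolding num_twin_classes_def by (rule card_inj_on_le)
qed

lemma ex_twin_transversal:
  assumes "pair_graph G"
  obtains R where "R \<subseteq> pverts G" "card R = num_twin_classes G"
    "\<And>v w. v \<in> R \<Longrightarrow> w \<in> R \<Longrightarrow> \<not> twins G v w"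
proof -
  have eq: "equiv (pverts G) (twin_rel G)" using assms by (rule equiv_twin_rel)
  define r where "r C = (SOME v. v \<in> C)" for C :: "'a set"
  have r: "r C \<in> C" if "C \<in> pverts G // twin_rel G" for C
    using in_quotient_imp_non_empty[OF eq that] unfolding r_def by (auto intro: someI)
  have disj: "C = D"
    if "C \<in> pverts G // twin_rel G" "D \<in> pverts G // twin_rel G" "(r C, r D) \<in> twin_rel G" for C D
    using quotient_eqI[OF eq that(1,2) r r that(3)] that by blast
  let ?R = "r ` (pverts G // twin_rel G)"
  have sub: "?R \<subseteq> pverts G" using r in_quotient_imp_subset[OF eq] by blast
  show thesis
  proof (rule that[OF sub])
    have "inj_on r (pverts G // twin_rel G)"
    proof (rule inj_onI)
      fix C D assume CD: "C \<in> pverts G // twin_rel G" "D \<in> pverts G // twin_rel G" "r C = r D"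
      then have "(r C, r D) \<in> twin_rel G" using sub by (auto simp: twin_rel_def)
      then show "C = D" using disj CD by blast
    qed
    then show "card ?R = num_twin_classes G"
      unfolding num_twin_classes_def by (rule card_image)
    show "\<not> twins G v w" if vw: "v \<in> ?R" "w \<in> ?R" for v w
    proof
      assume "twins G v w"
      then have "v \<noteq> w" "(v, w) \<in> twin_rel G"
        using vw sub by (auto simp: twin_rel_def twins_def)
      then show False using vw disj by blast
    qed
  qed
qed

section \<open>Distances\<close>

text \<open>
  The codes are the distances truncated at 2.
\<close>

lemma adj_code_le_gdist:
  assumes "pair_graph X"
  shows "ereal (adj_code X a c) \<le> gdist X a c"
proof -
  interpret pair_graph X by fact
  have "adj_code X a c \<le> length p" if "awalk a p c" for p
  proof (cases p)
    case Nil
    then show ?thesis using that by (simp add: awalk_Nil_iff adj_code_def)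
  next
    case (Cons e q)
    note [simp] = Cons
    show ?thesis
    proof (cases q)
      case Nil
      then show ?thesis using that by (auto simp: awalk_simps adj_code_def)
    next
      case Cons
      then show ?thesis by (simp add: adj_code_def)
    qed
  qed
  then show ?thesis
    unfolding gdist_conv_length[OF assms] by (auto intro!: INF_greatest)
qed

lemma gdist_eq_adj_code:
  assumes "pair_graph X" "a \<in> pverts X"
    and "a = c \<or> (a, c) \<in> parcs X \<or> (\<exists>y. (a, y) \<in> parcs X \<and> (y, c) \<in> parcs X)"
  shows "gdist X a c = ereal (adj_code X a c)"
proof (rule antisym[OF _ adj_code_le_gdist[OF assms(1)]])
  interpret pair_graph X by fact
  have "\<exists>p. awalk a p c \<and> length p \<le> adj_code X a c"
  proof (cases "a = c \<or> (a, c) \<in> parcs X")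
    case True
    then show ?thesis
    proof (cases "a = c")
      case True
      then show ?thesis using assms(2) by (intro exI[of _ "[]"]) (simp add: awalk_Nil_iff)
    next
      case False
      with True have "(a, c) \<in> parcs X" by blast
      then show ?thesis using False wellformed(2)[of "(a, c)"]
        by (intro exI[of _ "[(a, c)]"]) (simp add: awalk_simps adj_code_def)
    qed
  next
    case False
    then obtain y where y: "(a, y) \<in> parcs X" "(y, c) \<in> parcs X" using assms(3) by blast
    then show ?thesis using False wellformed(2)[of "(y, c)"]
      by (intro exI[of _ "[(a, y), (y, c)]"]) (simp add: awalk_simps adj_code_def)
  qed
  then obtain p where "awalk a p c" "length p \<le> adj_code X a c" by blast
  then show "gdist X a c \<le> ereal (adj_code X a c)"
    unfolding gdist_conv_length[OF assms(1)] by (intro INF_lower2[of p]) auto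
qed

text \<open>
  Here \<open>M\<close> is a module: a vertex outside is adjacent to all of \<open>M\<close> or to none of it. A walk from
  \<open>M\<close> to a vertex outside can be cut down to start at the vertex where it last leaves \<open>M\<close>, and
  that vertex can be replaced by any other element of \<open>M\<close>. In a lexicographic product this
  applies to the copy of \<open>H\<close> over one vertex and to the copies over a pair of twins.
\<close>

lemma gdist_constant_on_module:
  assumes "pair_graph X" "M \<subseteq> pverts X"
    and M: "\<And>a b y. a \<in> M \<Longrightarrow> b \<in> M \<Longrightarrow> y \<notin> M \<Longrightarrow> (a, y) \<in> parcs X \<Longrightarrow> (b, y) \<in> parcs X"
    and "a \<in> M" "b \<in> M" "c \<notin> M"
  shows "gdist X a c = gdist X b c"
proof -
  interpret pair_graph X by fact
  have walk: "\<exists>q. awalk b q c \<and> length q \<le> length p"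
    if "awalk a p c" "a \<in> M" "b \<in> M" for a b p
    using that
  proof (induction p arbitrary: a)
    case Nil
    then show ?case using \<open>c \<notin> M\<close> by (simp add: awalk_Nil_iff)
  next
    case (Cons e p)
    then have e: "e \<in> parcs X" "fst e = a" "awalk (snd e) p c" by (auto simp: awalk_Cons_iff)
    show ?case
    proof (cases "snd e \<in> M")
      case True
      then obtain q where "awalk b q c" "length q \<le> length p"
        using Cons.IH[OF e(3)] Cons.prems by blast
      then show ?thesis by (intro exI[of _ q]) simp
    next
      case False
      have "(a, snd e) \<in> parcs X" using e by auto
      then have "(b, snd e) \<in> parcs X" using M False Cons.prems by blast
      then have "awalk b ((b, snd e) # p) c" using e by (simp add: awalk_Cons_iff)
      then show ?thesis by (intro exI[of _ "(b, snd e) # p"]) simp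
    qed
  qed
  have "gdist X b c \<le> gdist X a c" if "a \<in> M" "b \<in> M" for a b
    unfolding gdist_conv_length[OF assms(1)]
  proof (rule INF_mono)
    fix p assume "p \<in> {p. awalk a p c}"
    then obtain q where "awalk b q c" "length q \<le> length p" using walk \<open>a \<in> M\<close> \<open>b \<in> M\<close> by blast
    then show "\<exists>q\<in>{q. awalk b q c}. ereal (length q) \<le> ereal (length p)" by auto
  qed
  then show ?thesis using assms(4,5) by (intro antisym)
qed

lemma connected_ex_neighbour:
  assumes "pair_graph G" "Digraph_Component.connected (with_proj G)"
    and "2 \<le> card (pverts G)" "v \<in> pverts G"
  obtains w where "(v, w) \<in> parcs G"
proof -
  interpret pair_graph G by fact
  have "\<not> pverts G \<subseteq> {v}"
    using assms(3) card_mono[of "{v}" "pverts G"] by auto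
  then obtain w where "w \<in> pverts G" "w \<noteq> v" by blast
  then have "v \<rightarrow>\<^sup>*\<^bsub>with_proj G\<^esub> w" "v \<noteq> w"
    using symmetric_connected_imp_strongly_connected[OF _ assms(2)] assms(4)
    by (auto simp: strongly_connected_def)
  then show thesis
    using that by (cases rule: converse_reachable_cases) auto
qed

section \<open>Separating sets of a lexicographic product\<close>

lemma pverts_lexicographic_product:
  "pverts (lexicographic_product G H) = pverts G \<times> pverts H"
  by (simp add: lexicographic_product_def)

lemma parcs_lexicographic_product_iff:
  "((v, u), (w, x)) \<in> parcs (lexicographic_product G H) \<longleftrightarrow>
    v \<in> pverts G \<and> w \<in> pverts G \<and> u \<in> pverts H \<and> x \<in> pverts H \<and>
    ((v, w) \<in> parcs G \<or> v = w \<and> (u, x) \<in> parcs H)"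
  by (auto simp: lexicographic_product_def)

text \<open>
  The copies of \<open>H\<close> over \<open>v\<close> and \<open>v'\<close> form a module. The relation \<open>twin_rel\<close> also allows
  \<open>v = v'\<close>, where the module is a single copy of \<open>H\<close>.
\<close>

lemma gdist_lexicographic_product_outside:
  assumes "pair_graph G" "pair_graph H" "(v, v') \<in> twin_rel G"
    and "u \<in> pverts H" "u' \<in> pverts H" "w \<noteq> v" "w \<noteq> v'"
  shows "gdist (lexicographic_product G H) (v, u) (w, x) =
    gdist (lexicographic_product G H) (v', u') (w, x)"
proof (rule gdist_constant_on_module[where M = "{v, v'} \<times> pverts H"])
  show "pair_graph (lexicographic_product G H)"
    using assms(1,2) by (rule pair_graph_lexicographic_product)
  have V: "v \<in> pverts G" "v' \<in> pverts G" using assms(3) by (auto simp: twin_rel_def)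
  then show "{v, v'} \<times> pverts H \<subseteq> pverts (lexicographic_product G H)"
    by (auto simp: pverts_lexicographic_product)
  have tw: "(v, z) \<in> parcs G \<longleftrightarrow> (v', z) \<in> parcs G" if "z \<noteq> v" "z \<noteq> v'" for z
    using assms(3) that twins_adjacent_iff[of G v v' z] by (auto simp: twin_rel_def)
  show "(b, y) \<in> parcs (lexicographic_product G H)"
    if ab: "a \<in> {v, v'} \<times> pverts H" "b \<in> {v, v'} \<times> pverts H" and y: "y \<notin> {v, v'} \<times> pverts H"
      and arc: "(a, y) \<in> parcs (lexicographic_product G H)" for a b y
  proof -
    obtain a1 a2 b1 b2 z x where [simp]: "a = (a1, a2)" "b = (b1, b2)" "y = (z, x)"
      by (cases a, cases b, cases y)
    have z: "z \<noteq> v" "z \<noteq> v'" and "(a1, z) \<in> parcs G"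
      using ab y arc by (auto simp: parcs_lexicographic_product_iff)
    then have "(b1, z) \<in> parcs G" using ab tw[OF z] by auto
    then show ?thesis using ab arc V by (auto simp: parcs_lexicographic_product_iff)
  qed
qed (use assms in auto)

text \<open>
  Any two vertices over \<open>v\<close> have a common neighbour over the neighbour \<open>w\<close> of \<open>v\<close>, so distances
  within a fibre never exceed 2, even if \<open>H\<close> is disconnected.
\<close>

lemma gdist_lexicographic_product_fibre:
  assumes "pair_graph G" "pair_graph H" "(v, w) \<in> parcs G"
    and "u \<in> pverts H" "x \<in> pverts H"
  shows "gdist (lexicographic_product G H) (v, u) (v, x) = ereal (adj_code H u x)"
proof -
  interpret G: pair_graph G by fact
  have V: "v \<in> pverts G" "w \<in> pverts G" using G.wellformed[OF assms(3)] by auto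
  have "((v, u), (w, u)) \<in> parcs (lexicographic_product G H)"
    "((w, u), (v, x)) \<in> parcs (lexicographic_product G H)"
    using assms V G.arcs_symmetric[OF assms(3)] by (auto simp: parcs_lexicographic_product_iff)
  then have "gdist (lexicographic_product G H) (v, u) (v, x) =
      ereal (adj_code (lexicographic_product G H) (v, u) (v, x))"
    using V assms by (intro gdist_eq_adj_code pair_graph_lexicographic_product)
      (auto simp: pverts_lexicographic_product)
  also have "adj_code (lexicographic_product G H) (v, u) (v, x) = adj_code H u x"
    using V assms(4,5) G.no_loops'[of v] by (auto simp: adj_code_def parcs_lexicographic_product_iff)
  finally show ?thesis .
qed

text \<open>
  Twins that are not adjacent share the neighbour \<open>w\<close>, which again bounds the distance by 2.
\<close>

lemma gdist_lexicographic_product_twins: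
  assumes "pair_graph G" "pair_graph H" "(v, w) \<in> parcs G" "v' \<in> pverts G" "twins G v v'"
    and "u \<in> pverts H" "x \<in> pverts H"
  shows "gdist (lexicographic_product G H) (v, u) (v', x) = ereal (adj_code G v v')"
proof -
  interpret G: pair_graph G by fact
  have V: "v \<in> pverts G" "w \<in> pverts G" using G.wellformed[OF assms(3)] by auto
  have ne: "v \<noteq> v'" using assms(5) by (simp add: twins_def)
  have nbr: "((v, u), (w, u)) \<in> parcs (lexicographic_product G H)"
    using assms V by (auto simp: parcs_lexicographic_product_iff)
  have "((w, u), (v', x)) \<in> parcs (lexicographic_product G H)" if "(v, v') \<notin> parcs G"
  proof -
    have "(v', w) \<in> parcs G"
      using that assms(3) twins_adjacent_iff[OF assms(5), of w] G.no_loops'[of v] by metis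
    then show ?thesis using assms V G.arcs_symmetric by (auto simp: parcs_lexicographic_product_iff)
  qed
  with nbr have "gdist (lexicographic_product G H) (v, u) (v', x) =
      ereal (adj_code (lexicographic_product G H) (v, u) (v', x))"
    using V assms by (intro gdist_eq_adj_code pair_graph_lexicographic_product)
      (auto simp: pverts_lexicographic_product parcs_lexicographic_product_iff)
  also have "adj_code (lexicographic_product G H) (v, u) (v', x) = adj_code G v v'"
    using V assms(4,6,7) ne by (auto simp: adj_code_def parcs_lexicographic_product_iff)
  finally show ?thesis .
qed

text \<open>
  The first distance is 1, the second at least 2.
\<close>

lemma gdist_lexicographic_product_neq:
  assumes "pair_graph G" "pair_graph H" "(v, z) \<in> parcs G" "(v', z) \<notin> parcs G" "v' \<noteq> z"
    and "u \<in> pverts H" "x \<in> pverts H"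
  shows "gdist (lexicographic_product G H) (v, u) (z, x) \<noteq>
    gdist (lexicographic_product G H) (v', u') (z, x)"
proof -
  interpret G: pair_graph G by fact
  have V: "v \<in> pverts G" "z \<in> pverts G" "v \<noteq> z"
    using G.wellformed[OF assms(3)] G.no_loops' assms(3) by auto
  have L: "pair_graph (lexicographic_product G H)"
    using assms(1,2) by (rule pair_graph_lexicographic_product)
  have "gdist (lexicographic_product G H) (v, u) (z, x) =
      ereal (adj_code (lexicographic_product G H) (v, u) (z, x))"
    using V assms by (intro gdist_eq_adj_code[OF L])
      (auto simp: pverts_lexicographic_product parcs_lexicographic_product_iff)
  also have "adj_code (lexicographic_product G H) (v, u) (z, x) = 1"
    using V assms by (auto simp: adj_code_def parcs_lexicographic_product_iff)
  finally have 1: "gdist (lexicographic_product G H) (v, u) (z, x) = 1" by simp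
  have "adj_code (lexicographic_product G H) (v', u') (z, x) = 2"
    using assms by (auto simp: adj_code_def parcs_lexicographic_product_iff)
  then have "2 \<le> gdist (lexicographic_product G H) (v', u') (z, x)"
    using adj_code_le_gdist[OF L, of "(v', u')" "(z, x)"] by simp
  with 1 show ?thesis by auto
qed

text \<open>
  The set version of having a vertex whose adjacency representation is entirely \<open>i\<close>.
\<close>

definition has_constant_vertex :: "'b pair_pre_digraph \<Rightarrow> 'b set \<Rightarrow> nat \<Rightarrow> bool" where
  "has_constant_vertex H S i \<longleftrightarrow> (\<exists>u\<in>pverts H. \<forall>s\<in>S. adj_code H u s = i)"

text \<open>
  The fibres alone decide whether a set is resolving. The condition on twins expresses that
  \<open>(v, u)\<close> and \<open>(w, u')\<close> have equal distances to \<open>S\<close> iff all codes of \<open>u\<close> and \<open>u'\<close> on their own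
  fibres equal the distance of \<open>v\<close> and \<open>w\<close>, because the elements of \<open>S\<close> over other vertices cannot
  tell twins apart. For vertices over distinct \<open>v\<close> and \<open>w\<close> that are not twins, some \<open>z\<close> is adjacent
  to exactly one of them, and an element of \<open>S\<close> over \<open>z\<close> separates; the fibre over \<open>z\<close> is nonempty,
  as the empty set cannot separate two vertices of \<open>H\<close>.
\<close>

lemma separating_lexicographic_product_iff:
  assumes G: "pair_graph G" "Digraph_Component.connected (with_proj G)" "2 \<le> card (pverts G)"
    and H: "pair_graph H" "2 \<le> card (pverts H)"
    and S: "S \<subseteq> pverts G \<times> pverts H"
  shows "separating (gdist (lexicographic_product G H)) (pverts G \<times> pverts H) S \<longleftrightarrow>
    (\<forall>v\<in>pverts G. separating (adj_code H) (pverts H) (S `` {v})) \<and>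
    (\<forall>v\<in>pverts G. \<forall>w\<in>pverts G. twins G v w \<longrightarrow>
      \<not> (has_constant_vertex H (S `` {v}) (adj_code G v w) \<and>
         has_constant_vertex H (S `` {w}) (adj_code G v w)))"
    (is "?sep \<longleftrightarrow> ?fib \<and> ?tw")
proof -
  let ?d = "gdist (lexicographic_product G H)"
  have fib: "?d (v, u) (v, x) = ereal (adj_code H u x)"
    if "v \<in> pverts G" "u \<in> pverts H" "x \<in> pverts H" for v u x
    using connected_ex_neighbour[OF G that(1)] gdist_lexicographic_product_fibre[OF G(1) H(1)] that
    by metis
  have twn: "?d (v, u) (w, x) = ereal (adj_code G v w)"
    if "v \<in> pverts G" "w \<in> pverts G" "twins G v w" "u \<in> pverts H" "x \<in> pverts H" for v w u x
    using connected_ex_neighbour[OF G that(1)] gdist_lexicographic_product_twins[OF G(1) H(1)] that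
    by metis
  note out = gdist_lexicographic_product_outside[OF G(1) H(1)]
  have Sin: "z \<in> pverts G" "x \<in> pverts H" if "(z, x) \<in> S" for z x
    using S that by auto
  show ?thesis
  proof (intro iffI conjI)
    assume sep: ?sep
    show ?fib
    proof
      fix v assume v: "v \<in> pverts G"
      have "u = u'" if u: "u \<in> pverts H" "u' \<in> pverts H"
        and eq: "\<forall>s\<in>S `` {v}. adj_code H u s = adj_code H u' s" for u u'
      proof -
        have "?d (v, u) s = ?d (v, u') s" if s: "s \<in> S" for s
        proof -
          obtain z x where [simp]: "s = (z, x)" by (cases s)
          show ?thesis
          proof (cases "z = v")
            case True
            then show ?thesis using s eq v u Sin[of z x] by (simp add: fib Image_singleton)
          next
            case False
            moreover have "(v, v) \<in> twin_rel G" using v by (simp add: twin_rel_def)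
            ultimately show ?thesis using out[of v v u u' z x] u by simp
          qed
        qed
        then show ?thesis using separatingD[OF sep, of "(v, u)" "(v, u')"] v u by simp
      qed
      then show "separating (adj_code H) (pverts H) (S `` {v})"
        using S by (auto simp: separating_def)
    qed
    show ?tw
    proof (intro ballI impI notI)
      fix v w assume vw: "v \<in> pverts G" "w \<in> pverts G" and t: "twins G v w"
        and c: "has_constant_vertex H (S `` {v}) (adj_code G v w) \<and>
          has_constant_vertex H (S `` {w}) (adj_code G v w)"
      obtain u u' where u: "u \<in> pverts H" "\<forall>s\<in>S `` {v}. adj_code H u s = adj_code G v w"
        and u': "u' \<in> pverts H" "\<forall>s\<in>S `` {w}. adj_code H u' s = adj_code G v w"
        using c unfolding has_constant_vertex_def by blast
      have t': "twins G w v" using t by (simp add: twins_commute)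
      have "?d (v, u) s = ?d (w, u') s" if s: "s \<in> S" for s
      proof -
        obtain z x where [simp]: "s = (z, x)" by (cases s)
        have x: "x \<in> pverts H" using Sin s by simp
        consider "z = v" | "z = w" | "z \<noteq> v" "z \<noteq> w" by blast
        then show ?thesis
        proof cases
          case 1
          then show ?thesis
            using s u u' x vw t' adj_code_commute[OF G(1), of w v] by (simp add: fib twn Image_singleton)
        next
          case 2
          then show ?thesis
            using s u u' x vw t by (simp add: fib twn Image_singleton)
        next
          case 3
          moreover have "(v, w) \<in> twin_rel G" using vw t by (simp add: twin_rel_def)
          ultimately show ?thesis using out[of v w u u' z x] u u' by simp
        qed
      qed
      then have "(v, u) = (w, u')"
        using separatingD[OF sep, of "(v, u)" "(w, u')"] vw u u' by simp
      then show False using t by (simp add: twins_def)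
    qed
  next
    assume A: "?fib \<and> ?tw"
    have ne: "\<exists>x. (z, x) \<in> S" if "z \<in> pverts G" for z
    proof (rule ccontr)
      assume "\<nexists>x. (z, x) \<in> S"
      then have "separating (adj_code H) (pverts H) {}"
        using A that by (metis Image_singleton_iff all_not_in_conv)
      then have "\<forall>x\<in>pverts H. \<forall>y\<in>pverts H. x = y" by (simp add: separating_def)
      then show False using H(2) card_le_Suc0_iff_eq[of "pverts H"] by (cases "finite (pverts H)") auto
    qed
    have tw: "v = v' \<or> twins G v v'"
      if V: "v \<in> pverts G" "v' \<in> pverts G" "u \<in> pverts H" "u' \<in> pverts H"
        and eq: "\<And>s. s \<in> S \<Longrightarrow> ?d (v, u) s = ?d (v', u') s" for v u v' u'
    proof -
      interpret G: pair_graph G by fact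
      have "(b, z) \<in> parcs G"
        if "(a, z) \<in> parcs G" "b \<noteq> z" "a \<in> pverts G" "b \<in> pverts G" "p \<in> pverts H" "q \<in> pverts H"
          and "\<And>s. s \<in> S \<Longrightarrow> ?d (a, p) s = ?d (b, q) s" for a b p q z
      proof (rule ccontr)
        assume n: "(b, z) \<notin> parcs G"
        have "z \<in> pverts G" using G.wellformed[OF that(1)] by simp
        then obtain x where x: "(z, x) \<in> S" using ne by blast
        then show False
          using gdist_lexicographic_product_neq[OF G(1) H(1) that(1) n that(2,5), of x q]
            that(7)[OF x] Sin by blast
      qed
      from this[of v _ v' u u'] this[of v' _ v u' u] show ?thesis
        using V eq G.no_loops'[of v v] G.no_loops'[of v' v']
        unfolding twins_def nbrs_def by auto
    qed
    show ?sep
      unfolding separating_def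
    proof (intro conjI S ballI impI)
      fix a b assume ab: "a \<in> pverts G \<times> pverts H" "b \<in> pverts G \<times> pverts H"
        and eq: "\<forall>s\<in>S. ?d a s = ?d b s"
      obtain v u v' u' where [simp]: "a = (v, u)" "b = (v', u')" by (cases a, cases b)
      have V: "v \<in> pverts G" "v' \<in> pverts G" "u \<in> pverts H" "u' \<in> pverts H" using ab by auto
      have eq': "?d (v, u) (z, x) = ?d (v', u') (z, x)" if "(z, x) \<in> S" for z x
        using eq that by simp
      consider "v = v'" | "twins G v v'" using tw[OF V] eq by auto
      then show "a = b"
      proof cases
        case 1
        have "adj_code H u x = adj_code H u' x" if "x \<in> S `` {v}" for x
          using eq'[of v x] that V 1 Sin[of v x] by (simp add: fib)
        then have "u = u'" using A V separatingD[of "adj_code H" "pverts H" "S `` {v}" u u'] by blast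
        then show ?thesis using 1 by simp
      next
        case 2
        then have t': "twins G v' v" by (simp add: twins_commute)
        have "adj_code H u x = adj_code G v v'" if "x \<in> S `` {v}" for x
          using eq'[of v x] that V t' Sin[of v x] adj_code_commute[OF G(1), of v v']
          by (simp add: fib twn)
        moreover have "adj_code H u' x = adj_code G v v'" if "x \<in> S `` {v'}" for x
          using eq'[of v' x] that V 2 Sin[of v' x] by (simp add: fib twn)
        ultimately have "has_constant_vertex H (S `` {v}) (adj_code G v v')"
          "has_constant_vertex H (S `` {v'}) (adj_code G v v')"
          unfolding has_constant_vertex_def using V by blast+
        then show ?thesis using A V 2 by blast
      qed
    qed
  qed
qed

section \<open>The metric dimension of the product\<close>

lemma adj_metric_dim_le_card:
  assumes "pair_graph H" "separating (adj_code H) (pverts H) S"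
  shows "adj_metric_dim H \<le> card S"
  unfolding adj_metric_dim_eq_Least_card[OF assms(1)] using assms(2) by (intro Least_le) blast

lemma ex_separating_card_adj_metric_dim:
  assumes "pair_graph H"
  obtains W where "separating (adj_code H) (pverts H) W" "card W = adj_metric_dim H"
proof -
  have "separating (adj_code H) (pverts H) (pverts H)"
    unfolding separating_def adj_code_def by (metis numeral_eq_one_iff one_neq_zero
        subset_refl zero_neq_numeral)
  then have "\<exists>k W. separating (adj_code H) (pverts H) W \<and> card W = k" by blast
  from LeastI_ex[OF this] show thesis
    using that unfolding adj_metric_dim_eq_Least_card[OF assms] by blast
qed

lemma adj_code_eq_0_iff [simp]: "adj_code H u v = 0 \<longleftrightarrow> u = v"
  by (simp add: adj_code_def)

lemma adj_code_cases: "u \<noteq> v \<Longrightarrow> adj_code H u v = 1 \<or> adj_code H u v = 2"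
  by (simp add: adj_code_def)

text \<open>
  As \<open>W\<close> separates, \<open>e\<close> is the only candidate, but its code to itself is 0.
\<close>

lemma no_constant_vertex_insert:
  assumes "separating (adj_code H) (pverts H) W"
    and "e \<in> pverts H" "\<forall>s\<in>W. adj_code H e s = i" "i \<noteq> 0"
  shows "\<not> has_constant_vertex H (insert e W) i"
proof
  assume "has_constant_vertex H (insert e W) i"
  then obtain u where u: "u \<in> pverts H" "\<forall>s\<in>insert e W. adj_code H u s = i"
    by (auto simp: has_constant_vertex_def)
  then have "u = e" using separatingD[OF assms(1), of u e] assms(2,3) by simp
  then show False using u(2) assms(4) by (metis insertI1 adj_code_eq_0_iff)
qed

lemma card_eq_sum_fibres:
  assumes "finite A" "finite B" "S \<subseteq> A \<times> B"
  shows "card S = (\<Sum>a\<in>A. card (S `` {a}))"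
proof -
  have "S = Sigma A (\<lambda>a. S `` {a})" using assms(3) by auto
  moreover have "finite (S `` {a})" for a
    using assms by (meson finite_Image finite_SigmaI finite_subset)
  ultimately show ?thesis using assms(1) by (metis card_SigmaI)
qed

text \<open>
  The fibres of a resolving set have at least \<open>adj_metric_dim H\<close> elements, and equality can occur
  once in each twin class but not twice. Stated as a sum, to avoid subtraction of natural numbers.
\<close>

lemma metric_dim_lexicographic_product:
  assumes G: "pair_graph G" "Digraph_Component.connected (with_proj G)" "2 \<le> card (pverts G)"
    and H: "pair_graph H" "2 \<le> card (pverts H)"
    and const: "\<And>W i. separating (adj_code H) (pverts H) W \<Longrightarrow> card W = adj_metric_dim H \<Longrightarrow>
      i \<in> {1, 2} \<Longrightarrow> has_constant_vertex H W i"
  shows "metric_dim (lexicographic_product G H) + num_twin_classes G =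
    card (pverts G) * (adj_metric_dim H + 1)"
proof -
  interpret G: pair_graph G by fact
  interpret H: pair_graph H by fact
  have fin: "finite (pverts G)" "finite (pverts H)"
    using G.finite_verts H.finite_verts by simp_all
  let ?\<beta> = "adj_metric_dim H"
  let ?sep = "separating (gdist (lexicographic_product G H)) (pverts G \<times> pverts H)"
  note sep_iff = separating_lexicographic_product_iff[OF G H]
  have lower: "card (pverts G) * (?\<beta> + 1) \<le> card S + num_twin_classes G" if S: "?sep S" for S
  proof -
    have sub: "S \<subseteq> pverts G \<times> pverts H" using S by (simp add: separating_def)
    \<comment> \<open>the vertices with a fibre of minimal size; no two of them are twins\<close>
    define T where "T = {v \<in> pverts G. card (S `` {v}) = ?\<beta>}"
    have fibre: "separating (adj_code H) (pverts H) (S `` {v})" if "v \<in> pverts G" for v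
      using S sep_iff[OF sub] that by blast
    have "?\<beta> + 1 \<le> card (S `` {v}) + (if v \<in> T then 1 else 0)" if "v \<in> pverts G" for v
      using adj_metric_dim_le_card[OF H(1) fibre[OF that]] that by (auto simp: T_def)
    then have "(\<Sum>v\<in>pverts G. ?\<beta> + 1) \<le>
        (\<Sum>v\<in>pverts G. card (S `` {v}) + (if v \<in> T then 1 else 0))"
      by (rule sum_mono)
    also have "\<dots> = card S + card T"
      using fin by (simp add: sum.distrib card_eq_sum_fibres[OF fin sub] T_def
          flip: sum.inter_filter)
    also have "card T \<le> num_twin_classes G"
    proof (rule card_le_num_twin_classes[OF G(1)])
      show "T \<subseteq> pverts G" by (auto simp: T_def)
      fix v w assume vw: "v \<in> T" "w \<in> T"
      show "\<not> twins G v w"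
      proof
        assume t: "twins G v w"
        then have "adj_code G v w \<in> {1, 2}" using adj_code_cases[of v w G] by (auto simp: twins_def)
        then have "has_constant_vertex H (S `` {v}) (adj_code G v w)"
          "has_constant_vertex H (S `` {w}) (adj_code G v w)"
          using const fibre vw by (auto simp: T_def)
        then show False using S sep_iff[OF sub] t vw by (auto simp: T_def)
      qed
    qed
    finally show ?thesis by simp
  qed
  obtain S where S: "?sep S" "card S + num_twin_classes G = card (pverts G) * (?\<beta> + 1)"
  proof -
    obtain W where W: "separating (adj_code H) (pverts H) W" "card W = ?\<beta>"
      using ex_separating_card_adj_metric_dim[OF H(1)] by blast
    have Wsub: "W \<subseteq> pverts H" using W by (simp add: separating_def)
    have finW: "finite W" using Wsub fin(2) by (rule finite_subset)
    obtain u1 u2 where u1: "u1 \<in> pverts H" "\<forall>s\<in>W. adj_code H u1 s = 1"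
      and u2: "u2 \<in> pverts H" "\<forall>s\<in>W. adj_code H u2 s = 2"
      using const[OF W, of 1] const[OF W, of 2] by (auto simp: has_constant_vertex_def)
    \<comment> \<open>only \<open>i = 1\<close> and \<open>i = 2\<close> matter, but \<open>e\<close> must take values in \<open>H\<close> outside \<open>W\<close> throughout\<close>
    define e where "e i = (if i = 1 then u1 else u2)" for i :: nat
    have e: "e i \<in> pverts H" "e i \<notin> W" for i
      using u1 u2 by (auto simp: e_def adj_code_def split: if_splits)
    have ei: "\<forall>s\<in>W. adj_code H (e i) s = i" if "i = 1 \<or> i = 2" for i
      using that u1 u2 by (auto simp: e_def)
    obtain R where R: "R \<subseteq> pverts G" "card R = num_twin_classes G"
      "\<And>v w. v \<in> R \<Longrightarrow> w \<in> R \<Longrightarrow> \<not> twins G v w"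
      using ex_twin_transversal[OF G(1)] by blast
    \<comment> \<open>any twin \<open>t v\<close> of \<open>v\<close> reveals the internal distance of the class; vertices outside \<open>R\<close> have one\<close>
    define t where "t v = (SOME w. twins G v w)" for v
    define F where "F v = (if v \<in> R then W else insert (e (adj_code G v (t v))) W)" for v
    define S where "S = Sigma (pverts G) F"
    have F: "S `` {v} = F v" if "v \<in> pverts G" for v using that by (auto simp: S_def)
    have sub: "S \<subseteq> pverts G \<times> pverts H" using Wsub e by (auto simp: S_def F_def split: if_splits)
    have not_const: "\<not> has_constant_vertex H (F v) (adj_code G v w)"
      if t: "twins G v w" and "v \<notin> R" for v w
    proof -
      have "twins G v (t v)" unfolding t_def using t by (rule someI)
      then have code: "adj_code G v (t v) = adj_code G v w"
        using twin_class_adj_code_eq[OF G(1) _ t] by blast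
      have i: "adj_code G v w = 1 \<or> adj_code G v w = 2"
        using t adj_code_cases[of v w G] by (auto simp: twins_def)
      then have "adj_code G v w \<noteq> 0" by linarith
      then have "\<not> has_constant_vertex H (insert (e (adj_code G v w)) W) (adj_code G v w)"
        by (rule no_constant_vertex_insert[OF W(1) e(1) ei[OF i]])
      then show ?thesis using \<open>v \<notin> R\<close> code by (simp add: F_def)
    qed
    have "?sep S"
      unfolding sep_iff[OF sub]
    proof (intro conjI ballI impI notI)
      fix v assume v: "v \<in> pverts G"
      show "separating (adj_code H) (pverts H) (S `` {v})"
        unfolding F[OF v]
        by (rule separating_superset[OF W(1)]) (use Wsub e in \<open>auto simp: F_def\<close>)
    next
      fix v w assume vw: "v \<in> pverts G" "w \<in> pverts G" and t: "twins G v w"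
        and c: "has_constant_vertex H (S `` {v}) (adj_code G v w) \<and>
          has_constant_vertex H (S `` {w}) (adj_code G v w)"
      have "v \<notin> R \<or> w \<notin> R" using R(3) t by blast
      then show False
      proof
        assume "v \<notin> R"
        from not_const[OF t this] show False using c F[OF vw(1)] by simp
      next
        assume "w \<notin> R"
        from not_const[OF _ this, of v] show False
          using c t F[OF vw(2)] twins_commute[of G v w] adj_code_commute[OF G(1), of v w] by simp
      qed
    qed
    moreover have "card S + num_twin_classes G = card (pverts G) * (?\<beta> + 1)"
    proof -
      have "card S = (\<Sum>v\<in>pverts G. card (F v))"
        unfolding card_eq_sum_fibres[OF fin sub] by (rule sum.cong) (simp_all add: F)
      moreover have "num_twin_classes G = (\<Sum>v\<in>pverts G. if v \<in> R then 1 else 0)"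
        using R(1,2) sum.inter_restrict[OF fin(1), of "\<lambda>_. 1::nat" R] by (simp add: Int_absorb1)
      ultimately have "card S + num_twin_classes G =
          (\<Sum>v\<in>pverts G. card (F v)) + (\<Sum>v\<in>pverts G. if v \<in> R then 1 else 0)"
        by simp
      also have "\<dots> = (\<Sum>v\<in>pverts G. card (F v) + (if v \<in> R then 1 else 0))"
        by (rule sum.distrib[symmetric])
      also have "\<dots> = (\<Sum>v\<in>pverts G. ?\<beta> + 1)"
        by (rule sum.cong) (use e(2) finW W(2) in \<open>auto simp: F_def\<close>)
      finally show ?thesis by simp
    qed
    ultimately show thesis by (rule that)
  qed
  have "metric_dim (lexicographic_product G H) = card S"
    unfolding metric_dim_eq_Least_card[OF pair_graph_lexicographic_product[OF G(1) H(1)]]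
      pverts_lexicographic_product
  proof (rule Least_equality)
    show "\<exists>T. ?sep T \<and> card T = card S" using S(1) by blast
    show "card S \<le> k" if k: "\<exists>T. ?sep T \<and> card T = k" for k
    proof -
      obtain T where "?sep T" "card T = k" using k by blast
      then show ?thesis using lower[of T] S(2) by linarith
    qed
  qed
  then show ?thesis using S(2) by simp
qed

lemma entirely_adj_rep_iff:
  "entirely i (adj_rep H ws u) \<longleftrightarrow> (\<forall>s\<in>set ws. adj_code H u s = i)"
  by (auto simp: entirely_def adj_rep_def)

lemma ex_adj_basis_set_eq:
  assumes "pair_graph H" "separating (adj_code H) (pverts H) W" "card W = adj_metric_dim H"
  obtains ws where "adj_basis H ws" "set ws = W"
proof -
  interpret pair_graph H by fact
  have "finite W"
    using assms(2) finite_verts by (auto simp: separating_def intro: finite_subset)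
  then obtain ws where ws: "set ws = W" "distinct ws" using finite_distinct_list by blast
  then have "adj_basis H ws"
    using assms(2,3) separating_set_iff[of "adj_code H" "pverts H" ws] distinct_card[OF ws(2)]
    by (simp add: adj_basis_def adj_resolving_def adj_rep_def[abs_def])
  then show thesis using ws(1) by (rule that)
qed

theorem theorem2:
  fixes G :: "'a pair_pre_digraph" and H :: "'b pair_pre_digraph" and n :: nat
  assumes "pair_graph G" and "Digraph_Component.connected (with_proj G)"
    and "card (pverts G) = n" and "n \<ge> 2"
    and "pair_graph H" and "card (pverts H) \<ge> 2"
    and "\<And>W. adj_basis H W \<Longrightarrow>
      (\<exists>u \<in> pverts H. entirely 1 (adj_rep H W u)) \<and>
      (\<exists>v \<in> pverts H. entirely 2 (adj_rep H W v))"
  shows "metric_dim (lexicographic_product G H) =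
      metric_dim (lexicographic_product G (complement_graph H)) \<and>
    int (metric_dim (lexicographic_product G (complement_graph H))) =
      int n * (int (adj_metric_dim H) + 1) - int (num_twin_classes G)"
proof -
  let ?H' = "complement_graph H"
  have const: "has_constant_vertex H W i"
    if W: "separating (adj_code H) (pverts H) W" "card W = adj_metric_dim H" and i: "i \<in> {1, 2}"
    for W i
  proof -
    obtain ws where "adj_basis H ws" "set ws = W" using ex_adj_basis_set_eq[OF assms(5) W] by blast
    then show ?thesis
      using assms(7)[of ws] i by (auto simp: entirely_adj_rep_iff has_constant_vertex_def)
  qed
  have const': "has_constant_vertex ?H' W i"
    if W: "separating (adj_code ?H') (pverts ?H') W" "card W = adj_metric_dim ?H'"
      and i: "i \<in> {1, 2}" for W i
  proof -
    have W': "separating (adj_code H) (pverts H) W" "card W = adj_metric_dim H"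
      using W adj_metric_dim_complement_graph[OF assms(5)]
      by (simp_all add: pverts_complement_graph separating_adj_code_complement_graph)
    have "W \<subseteq> pverts H" using W' by (simp add: separating_def)
    then have "has_constant_vertex ?H' W 1 \<longleftrightarrow> has_constant_vertex H W 2"
      "has_constant_vertex ?H' W 2 \<longleftrightarrow> has_constant_vertex H W 1"
      unfolding has_constant_vertex_def pverts_complement_graph
      by (auto intro!: bex_cong ball_cong simp: adj_code_complement_graph_iff subset_iff
          simp del: One_nat_def)
    then show ?thesis using const[OF W'] i by auto
  qed
  have n: "2 \<le> card (pverts G)" using assms(3,4) by simp
  have H': "2 \<le> card (pverts ?H')" using assms(6) by (simp add: pverts_complement_graph)
  have 1: "metric_dim (lexicographic_product G H) + num_twin_classes G = n * (adj_metric_dim H + 1)"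
    unfolding assms(3)[symmetric]
    by (rule metric_dim_lexicographic_product[OF assms(1,2) n assms(5,6) const])
  have 2: "metric_dim (lexicographic_product G ?H') + num_twin_classes G =
      n * (adj_metric_dim H + 1)"
    unfolding assms(3)[symmetric] adj_metric_dim_complement_graph[OF assms(5), symmetric]
    by (rule metric_dim_lexicographic_product[OF assms(1,2) n
          pair_graph_complement_graph[OF assms(5)] H' const'])
  have "int (metric_dim (lexicographic_product G ?H')) + int (num_twin_classes G) =
      int n * (int (adj_metric_dim H) + 1)"
    using arg_cong[OF 2, of int] by (simp only: of_nat_add of_nat_mult of_nat_1)
  then show ?thesis using 1 2 by linarith
qed

end
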